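(* Let $0<\varepsilon<1$. There exists a transcendental entire function $f$ such that $Q_\varepsilon(f)\ne A(f)$, and hence $Q(f)\ne A(f)$.
   Context: Here $\mathbb{N}=\{1,2,\dots\}$ and $f^n$ denotes the $n$th iterate of $f$. Put $M(r)=M(r,f)=\max_{|z|=r}|f(z)|$ for $r>0$, and let $M^n(r)$ denote the $n$th iterate of the function $M$. The fast escaping set is $$A(f)=\{z\in\mathbb{C}:\text{there exists }\ell\in\mathbb{N}\text{ such that }|f^{n+\ell}(z)|\ge M^n(R)\text{ for all }n\in\mathbb{N}\},$$ where $R>0$ is any value such that $M(r)>r$ for $r\ge R$. For $0<\varepsilon<1$ put $\mu_\varepsilon(r)=M(r)^\varepsilon$, $r>0$, with iterates $\mu_\varepsilon^n$, and $$Q_\varepsilon(f)=\{z\in\mathbb{C}:\text{there exists }\ell\in\mathbb{N}\text{ such that }|f^{n+\ell}(z)|\ge \mu_\varepsilon^n(R)\text{ for all }n\in\mathbb{N}\},$$ where $R>0$ is any value such that $\mu_\varepsilon(r)>r$ for $r\ge R$. These definitions do not depend on the choice of such $R$. The quite fast escaping set is $Q(f)=\bigcup_{0<\varepsilon<1}Q_\varepsilon(f)$. *)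

theory Defs
  imports "HOL-Complex_Analysis.Complex_Analysis" "HOL-Computational_Algebra.Polynomial"
begin

definition transcendental_entire :: "(complex \<Rightarrow> complex) \<Rightarrow> bool" where
  "transcendental_entire f \<longleftrightarrow>
     f holomorphic_on UNIV \<and> \<not> (\<exists>p :: complex poly. \<forall>z. f z = poly p z)"

text \<open>
  For continuous \<open>f\<close> and \<open>r > 0\<close> the supremum below is a maximum, since circles are compact.
\<close>

definition max_mod :: "(complex \<Rightarrow> complex) \<Rightarrow> real \<Rightarrow> real" where
  "max_mod f r = (SUP z\<in>sphere 0 r. cmod (f z))"

definition mu :: "real \<Rightarrow> (complex \<Rightarrow> complex) \<Rightarrow> real \<Rightarrow> real" where
  "mu \<epsilon> f r = max_mod f r powr \<epsilon>"

definition admissible_radius :: "(real \<Rightarrow> real) \<Rightarrow> real \<Rightarrow> bool" where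
  "admissible_radius g R \<longleftrightarrow> R > 0 \<and> (\<forall>r\<ge>R. g r > r)"

text \<open>
  The escaping sets are defined with ``any'' admissible radius \<open>R\<close>, the choice being immaterial.
  Here \<open>R\<close> is quantified existentially; below it is shown that admissible radii
  exist and that every fixed one gives the same set (\<open>fast_escaping_set_eq\<close>,
  \<open>quite_fast_escaping_set_at_eq\<close>).
  As the natural numbers start at 1, both \<open>l\<close> and \<open>n\<close> are positive.
\<close>

definition fast_escaping_set :: "(complex \<Rightarrow> complex) \<Rightarrow> complex set" where
  "fast_escaping_set f =
     {z. \<exists>R. admissible_radius (max_mod f) R \<and>
             (\<exists>l\<ge>1. \<forall>n\<ge>1. cmod ((f ^^ (n + l)) z) \<ge> (max_mod f ^^ n) R)}"

definition quite_fast_escaping_set_at :: "real \<Rightarrow> (complex \<Rightarrow> complex) \<Rightarrow> complex set" where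
  "quite_fast_escaping_set_at \<epsilon> f =
     {z. \<exists>R. admissible_radius (mu \<epsilon> f) R \<and>
             (\<exists>l\<ge>1. \<forall>n\<ge>1. cmod ((f ^^ (n + l)) z) \<ge> (mu \<epsilon> f ^^ n) R)}"

definition quite_fast_escaping_set :: "(complex \<Rightarrow> complex) \<Rightarrow> complex set" where
  "quite_fast_escaping_set f = (\<Union>\<epsilon>\<in>{0<..<1}. quite_fast_escaping_set_at \<epsilon> f)"

lemma max_mod_upper:
  assumes "f holomorphic_on UNIV" and "cmod z = r"
  shows "cmod (f z) \<le> max_mod f r"
proof -
  have "continuous_on (sphere 0 r) (\<lambda>z. cmod (f z))"
    using assms(1) by (intro continuous_intros holomorphic_on_imp_continuous_on)
      (auto intro: holomorphic_on_subset)
  then have "bdd_above ((\<lambda>z. cmod (f z)) ` sphere 0 r)"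
    by (intro bounded_imp_bdd_above compact_imp_bounded compact_continuous_image) auto
  then show ?thesis
    unfolding max_mod_def using assms(2) by (intro cSUP_upper) auto
qed

lemma max_mod_le:
  assumes "r > 0" and "\<And>z. cmod z = r \<Longrightarrow> cmod (f z) \<le> B"
  shows "max_mod f r \<le> B"
  unfolding max_mod_def using assms by (intro cSUP_least) auto

lemma max_mod_nonneg:
  assumes "f holomorphic_on UNIV" and "r > 0"
  shows "max_mod f r \<ge> 0"
  using max_mod_upper[OF assms(1), of "of_real r" r] assms(2)
  by (smt (verit) norm_ge_zero norm_of_real)

lemma max_mod_mono:
  assumes "f holomorphic_on UNIV" and "0 < r" and "r \<le> s"
  shows "max_mod f r \<le> max_mod f s"
proof (rule max_mod_le[OF assms(2)])
  fix z :: complex assume z: "cmod z = r"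
  show "cmod (f z) \<le> max_mod f s"
  proof (rule maximum_modulus_frontier[of f "cball 0 s"])
    show "f holomorphic_on interior (cball 0 s)" "continuous_on (closure (cball 0 s)) f"
      using assms(1) by (auto intro: holomorphic_on_subset holomorphic_on_imp_continuous_on)
    show "cmod (f w) \<le> max_mod f s" if "w \<in> frontier (cball 0 s)" for w
      using that assms by (intro max_mod_upper) auto
  qed (use z assms in auto)
qed

lemma max_mod_le_limit:
  assumes "f holomorphic_on UNIV" and "L > 0" and "x \<longlonglongrightarrow> L" and "\<And>n. x n > 0"
    and "\<And>n. max_mod f (x n) \<le> B"
  shows "max_mod f L \<le> B"
proof (rule max_mod_le[OF assms(2)])
  fix z :: complex assume z: "cmod z = L"
  have "continuous_on UNIV f" using assms(1) by (rule holomorphic_on_imp_continuous_on)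
  then have c: "isCont f w" for w by (simp add: continuous_on_eq_continuous_at)
  have "(\<lambda>n. of_real (x n / L) * z) \<longlonglongrightarrow> of_real (L / L) * z"
    using assms(2,3) by (intro tendsto_intros) auto
  then have "(\<lambda>n. of_real (x n / L) * z) \<longlonglongrightarrow> z" using assms(2) by simp
  then have lim: "(\<lambda>n. cmod (f (of_real (x n / L) * z))) \<longlonglongrightarrow> cmod (f z)"
    by (intro tendsto_norm isCont_tendsto_compose[OF c])
  have "cmod (of_real (x n / L) * z) = x n" for n
    using z assms(2) assms(4)[of n] by (simp add: norm_mult norm_divide)
  then have "cmod (f (of_real (x n / L) * z)) \<le> B" for n
    using max_mod_upper[OF assms(1)] assms(5) order_trans by blast
  then show "cmod (f z) \<le> B" using lim by (intro LIMSEQ_le_const2) auto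
qed

lemma admissible_iterates:
  fixes g :: "real \<Rightarrow> real"
  assumes adm: "admissible_radius g R"
  shows "(g ^^ n) R \<ge> R" and "(g ^^ n) R < (g ^^ Suc n) R"
proof -
  have gt: "r < g r" if "R \<le> r" for r
    using adm that unfolding admissible_radius_def by blast
  show *: "(g ^^ n) R \<ge> R" for n
  proof (induction n)
    case (Suc n)
    from gt[OF Suc] Suc have "R \<le> g ((g ^^ n) R)" by linarith
    then show ?case by simp
  qed simp
  show "(g ^^ n) R < (g ^^ Suc n) R" using gt[OF *[of n]] by simp
qed

lemma admissible_iterates_unbounded:
  assumes adm: "admissible_radius g R"
    and lim: "\<And>x L B. L > 0 \<Longrightarrow> x \<longlonglongrightarrow> L \<Longrightarrow> (\<And>n. x n > 0) \<Longrightarrow> (\<And>n. g (x n) \<le> B) \<Longrightarrow> g L \<le> B"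
  shows "\<exists>k. (g ^^ k) R \<ge> S"
proof (rule ccontr)
  assume "\<not> ?thesis"
  then have bd: "\<forall>k. (g ^^ k) R \<le> S" by (simp add: not_le less_imp_le)
  have inc: "incseq (\<lambda>n. (g ^^ n) R)"
    by (rule incseq_SucI) (rule less_imp_le[OF admissible_iterates(2)[OF adm]])
  obtain L where L: "(\<lambda>n. (g ^^ n) R) \<longlonglongrightarrow> L" and "\<forall>n. (g ^^ n) R \<le> L"
    by (rule incseq_convergent[OF inc bd])
  then have le: "(g ^^ n) R \<le> L" for n by blast
  have R: "R > 0" using adm by (simp add: admissible_radius_def)
  have "R \<le> L" using le[of 0] by simp
  have "g L \<le> L"
  proof (rule lim[OF _ L])
    show "(g ^^ n) R > 0" for n by (rule less_le_trans[OF R admissible_iterates(1)[OF adm]])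
    show "g ((g ^^ n) R) \<le> L" for n using le[of "Suc n"] by simp
    show "L > 0" using \<open>R \<le> L\<close> R by linarith
  qed
  moreover have "L < g L" using adm \<open>R \<le> L\<close> unfolding admissible_radius_def by blast
  ultimately show False by simp
qed

lemma escaping_radius_independent:
  fixes u :: "nat \<Rightarrow> real"
  assumes R: "admissible_radius g R" and S: "admissible_radius g S"
    and mono: "\<And>r s. 0 < r \<Longrightarrow> r \<le> s \<Longrightarrow> g r \<le> g s"
    and lim: "\<And>x L B. L > 0 \<Longrightarrow> x \<longlonglongrightarrow> L \<Longrightarrow> (\<And>n. x n > 0) \<Longrightarrow> (\<And>n. g (x n) \<le> B) \<Longrightarrow> g L \<le> B"
    and u: "\<exists>l\<ge>1. \<forall>n\<ge>1. u (n + l) \<ge> (g ^^ n) R"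
  shows "\<exists>l\<ge>1. \<forall>n\<ge>1. u (n + l) \<ge> (g ^^ n) S"
proof -
  obtain l where l: "l \<ge> 1" "\<And>n. n \<ge> 1 \<Longrightarrow> u (n + l) \<ge> (g ^^ n) R" using u by blast
  have "\<exists>k. (g ^^ k) R \<ge> S" by (rule admissible_iterates_unbounded[OF R]) (fact lim)
  then obtain k where k: "(g ^^ k) R \<ge> S" by blast
  have *: "(g ^^ n) S \<le> (g ^^ (n + k)) R" for n
  proof (induction n)
    case (Suc n)
    have "(g ^^ n) S > 0"
      using admissible_iterates(1)[OF S, of n] S by (auto simp: admissible_radius_def)
    with Suc show ?case using mono by simp
  qed (use k in simp)
  have "(g ^^ n) S \<le> u (n + (k + l))" if "n \<ge> 1" for n
    using *[of n] l(2)[of "n + k"] that by (simp add: add.assoc)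
  then show ?thesis using l(1) by (intro exI[of _ "k + l"]) auto
qed

lemma fast_escaping_set_eq:
  assumes "f holomorphic_on UNIV" and "admissible_radius (max_mod f) R"
  shows "fast_escaping_set f =
           {z. \<exists>l\<ge>1. \<forall>n\<ge>1. cmod ((f ^^ (n + l)) z) \<ge> (max_mod f ^^ n) R}"
proof -
  have "\<exists>l\<ge>1. \<forall>n\<ge>1. cmod ((f ^^ (n + l)) z) \<ge> (max_mod f ^^ n) R"
    if "admissible_radius (max_mod f) S"
      and "\<exists>l\<ge>1. \<forall>n\<ge>1. cmod ((f ^^ (n + l)) z) \<ge> (max_mod f ^^ n) S" for z S
    by (rule escaping_radius_independent[where u = "\<lambda>m. cmod ((f ^^ m) z)", OF that(1) assms(2) _ _ that(2)])
      (fact max_mod_mono[OF assms(1)], fact max_mod_le_limit[OF assms(1)])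
  then show ?thesis unfolding fast_escaping_set_def using assms(2) by blast
qed

lemma mu_mono:
  assumes "f holomorphic_on UNIV" and "\<epsilon> > 0" and "0 < r" and "r \<le> s"
  shows "mu \<epsilon> f r \<le> mu \<epsilon> f s"
  unfolding mu_def
  using assms(2) max_mod_nonneg[OF assms(1,3)] max_mod_mono[OF assms(1,3,4)]
  by (intro powr_mono2) auto

lemma mu_le_limit:
  assumes f: "f holomorphic_on UNIV" and e: "\<epsilon> > 0"
    and "L > 0" and "x \<longlonglongrightarrow> L" and pos: "\<And>n. x n > 0"
    and le: "\<And>n. mu \<epsilon> f (x n) \<le> B"
  shows "mu \<epsilon> f L \<le> B"
proof -
  have B: "B \<ge> 0" using le[of 0] by (smt (verit) mu_def powr_ge_zero)
  have "max_mod f (x n) \<le> B powr (1 / \<epsilon>)" for n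
  proof -
    have "(max_mod f (x n) powr \<epsilon>) powr (1 / \<epsilon>) \<le> B powr (1 / \<epsilon>)"
      using le[of n] e by (intro powr_mono2) (auto simp: mu_def)
    then show ?thesis using e max_mod_nonneg[OF f pos] by (simp add: powr_powr)
  qed
  then have "max_mod f L \<le> B powr (1 / \<epsilon>)"
    by (rule max_mod_le_limit[OF f assms(3,4) pos])
  then have "mu \<epsilon> f L \<le> (B powr (1 / \<epsilon>)) powr \<epsilon>"
    unfolding mu_def using e max_mod_nonneg[OF f \<open>L > 0\<close>] by (intro powr_mono2) auto
  then show ?thesis using e B by (simp add: powr_powr)
qed

lemma quite_fast_escaping_set_at_eq:
  assumes "f holomorphic_on UNIV" and "\<epsilon> > 0" and "admissible_radius (mu \<epsilon> f) R"
  shows "quite_fast_escaping_set_at \<epsilon> f =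
           {z. \<exists>l\<ge>1. \<forall>n\<ge>1. cmod ((f ^^ (n + l)) z) \<ge> (mu \<epsilon> f ^^ n) R}"
proof -
  have "\<exists>l\<ge>1. \<forall>n\<ge>1. cmod ((f ^^ (n + l)) z) \<ge> (mu \<epsilon> f ^^ n) R"
    if "admissible_radius (mu \<epsilon> f) S"
      and "\<exists>l\<ge>1. \<forall>n\<ge>1. cmod ((f ^^ (n + l)) z) \<ge> (mu \<epsilon> f ^^ n) S" for z S
    by (rule escaping_radius_independent[where u = "\<lambda>m. cmod ((f ^^ m) z)", OF that(1) assms(3) _ _ that(2)])
      (fact mu_mono[OF assms(1,2)], fact mu_le_limit[OF assms(1,2)])
  then show ?thesis unfolding quite_fast_escaping_set_at_def using assms(3) by blast
qed

lemma mu_admissible_exists: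
  assumes f: "transcendental_entire f" and e: "\<epsilon> > 0"
  shows "\<exists>R. admissible_radius (mu \<epsilon> f) R"
proof (rule ccontr)
  assume no: "\<not> ?thesis"
  have holf: "f holomorphic_on UNIV" using f by (simp add: transcendental_entire_def)
  obtain n :: nat where n: "1 / \<epsilon> \<le> real n" using real_arch_simple by blast
  have ex: "\<exists>r\<ge>S. r \<ge> 1 \<and> max_mod f r \<le> r ^ n" for S
  proof -
    have "\<not> admissible_radius (mu \<epsilon> f) (max 1 S)" using no by blast
    then obtain r where r: "r \<ge> 1" "r \<ge> S" "mu \<epsilon> f r \<le> r"
      by (auto simp: admissible_radius_def not_less)
    then have "(max_mod f r powr \<epsilon>) powr (1 / \<epsilon>) \<le> r powr (1 / \<epsilon>)"
      using e by (intro powr_mono2) (auto simp: mu_def)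
    then have "max_mod f r \<le> r powr (1 / \<epsilon>)"
      using e max_mod_nonneg[OF holf, of r] r(1) by (simp add: powr_powr)
    also have "\<dots> \<le> r powr real n" using n r(1) by (rule powr_mono)
    also have "\<dots> = r ^ n" using r(1) by (simp add: powr_realpow)
    finally show ?thesis using r by blast
  qed
  have zero: "(deriv ^^ k) f 0 = 0" if k: "k > n" for k
  proof (rule ccontr)
    define d where "d = cmod ((deriv ^^ k) f 0)"
    assume "(deriv ^^ k) f 0 \<noteq> 0"
    then have d: "d > 0" by (simp add: d_def)
    obtain r where r: "r \<ge> fact k / d + 1" "r \<ge> 1" "max_mod f r \<le> r ^ n" using ex by blast
    have "d \<le> fact k * r ^ n / r ^ k"
      unfolding d_def
    proof (rule Cauchy_inequality)
      show "f holomorphic_on ball 0 r" "continuous_on (cball 0 r) f"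
        using holf by (auto intro: holomorphic_on_subset holomorphic_on_imp_continuous_on)
      show "cmod (f x) \<le> r ^ n" if "cmod (0 - x) = r" for x
        using max_mod_upper[OF holf, of x r] that r(3) by simp
    qed (use r(2) in simp)
    also have "\<dots> = fact k / r ^ (k - n)"
      using k r(2) by (simp add: power_diff)
    also have "\<dots> \<le> fact k / r"
      using k r(2) self_le_power[of r "k - n"] by (intro divide_left_mono) auto
    finally have "d * r \<le> fact k" using r(2) by (simp add: field_simps)
    moreover have "d * r \<ge> d * (fact k / d + 1)"
      using r(1) d by (intro mult_left_mono) auto
    moreover have "d * (fact k / d + 1) = fact k + d" using d by (simp add: field_simps)
    ultimately show False using d by linarith
  qed
  have "f z = poly (\<Sum>k\<le>n. monom ((deriv ^^ k) f 0 / fact k) k) z" for z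
  proof -
    have "(\<lambda>k. (deriv ^^ k) f 0 / fact k * (z - 0) ^ k) sums f z"
      by (rule holomorphic_power_series[where r = "cmod z + 1"])
        (use holf in \<open>auto intro: holomorphic_on_subset\<close>)
    moreover have "(\<lambda>k. (deriv ^^ k) f 0 / fact k * (z - 0) ^ k) sums
        (\<Sum>k\<le>n. (deriv ^^ k) f 0 / fact k * (z - 0) ^ k)"
      by (rule sums_finite) (use zero in auto)
    ultimately have "f z = (\<Sum>k\<le>n. (deriv ^^ k) f 0 / fact k * (z - 0) ^ k)"
      using sums_unique2 by blast
    then show ?thesis by (simp add: poly_sum poly_monom)
  qed
  then show False using f by (auto simp: transcendental_entire_def)
qed

lemma max_mod_admissible_exists:
  assumes "transcendental_entire f"
  shows "\<exists>R. admissible_radius (max_mod f) R"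
proof -
  obtain R where "admissible_radius (mu 1 f) R" using mu_admissible_exists[OF assms] by force
  then have "admissible_radius (max_mod f) R"
    using assms max_mod_nonneg[of f] by (auto simp: admissible_radius_def mu_def transcendental_entire_def)
  then show ?thesis ..
qed

end

theory Submission
  imports Defs "HOL-Real_Asymp.Real_Asymp"
begin

text \<open>
  Take \<open>f z = z^N * (\<Prod>k. 1 - z / a k)^2\<close> with positive zeros \<open>a k\<close>, so sparse that near
  \<open>\<bar>z\<bar> = a n\<close> the function has the size of \<open>z^d\<close> with \<open>d = N + 2 * n\<close>. The zeros satisfy
  \<open>a (n + 1) = a n powr (\<eta> * d)\<close> for some \<open>\<epsilon> < \<eta> < 1\<close>. Being nonnegative on the positive axis and
  zero at \<open>a n\<close>, \<open>f\<close> maps \<open>[a n, 2 * a n]\<close> over \<open>[a (n + 1), 2 * a (n + 1)]\<close>, so some real orbit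
  visits these intervals in turn. It loses a factor of about \<open>\<eta>\<close> in \<open>ln\<close> against \<open>M\<close> at each step, which
  \<open>\<epsilon> < \<eta>\<close> permits in the quite fast escaping set. After \<open>n\<close> steps \<open>ln M^n(R)\<close> is ahead by an
  exponential factor, whereas the degrees grow linearly in \<open>n\<close>, so that a head start of \<open>l\<close>
  iterations gains only a factor polynomial in \<open>n\<close>: the orbit is not fast escaping.
\<close>

section \<open>Auxiliary facts on orbits, products and growth\<close>

text \<open>The points whose first \<open>n\<close> iterates lie in the prescribed sets form
  decreasing compact sets \<open>J n\<close>. These are nonempty, because any point of
  \<open>I n\<close> can be pulled back step by step through the coverings, so they have a common
  point.\<close>

lemma nested_orbit_exists:
  fixes h :: "'a :: heine_borel \<Rightarrow> 'a"
  assumes cont: "continuous_on UNIV h"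
    and comp: "\<And>n. compact (I n)" and ne: "\<And>n. I n \<noteq> {}"
    and cover: "\<And>n. I (Suc n) \<subseteq> h ` I n"
  shows "\<exists>x. \<forall>n. (h ^^ n) x \<in> I n"
proof -
  define J where "J n = (\<Inter>k\<in>{..n}. (h ^^ k) -` I k)" for n
  have contn: "continuous_on UNIV (h ^^ n)" for n
  proof (induction n)
    case (Suc n)
    then show ?case
      using continuous_on_compose[OF Suc continuous_on_subset[OF cont]] by (simp add: o_def)
  qed (simp add: id_def)
  have "\<Inter>(range J) \<noteq> {}"
  proof (rule compact_nest)
    fix n
    have "closed (J n)"
      unfolding J_def
      by (intro closed_INT ballI closed_vimage contn compact_imp_closed comp)
    moreover have "J n = I 0 \<inter> J n"
      by (auto simp: J_def)
    ultimately show "compact (J n)"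
      by (metis compact_Int_closed comp)
    have "\<exists>x\<in>J n. (h ^^ n) x = y" if "y \<in> I n" for y
      using that
    proof (induction n arbitrary: y)
      case (Suc n)
      then obtain w where w: "w \<in> I n" "h w = y" using cover by blast
      then obtain x where x: "x \<in> J n" "(h ^^ n) x = w" using Suc.IH by blast
      then have "(h ^^ Suc n) x = y" using w by simp
      moreover have "x \<in> J (Suc n)"
        using x(1) Suc.prems \<open>(h ^^ Suc n) x = y\<close> unfolding J_def atMost_Suc by auto
      ultimately show ?case by blast
    qed (simp add: J_def)
    then show "J n \<noteq> {}" using ne[of n] by blast
  qed (auto simp: J_def)
  then obtain x where "x \<in> J n" for n by blast
  then have "(h ^^ n) x \<in> I n" for n by (auto simp: J_def)
  then show ?thesis by blast
qed

lemma prod_one_plus_le_exp_sum: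
  fixes x :: "'a \<Rightarrow> real"
  assumes "\<And>k. k \<in> A \<Longrightarrow> 0 \<le> x k"
  shows "(\<Prod>k\<in>A. 1 + x k) \<le> exp (\<Sum>k\<in>A. x k)"
proof (cases "finite A")
  case True
  have "(\<Prod>k\<in>A. 1 + x k) \<le> (\<Prod>k\<in>A. exp (x k))"
    using assms by (intro prod_mono) (auto intro: add_nonneg_nonneg)
  then show ?thesis using True by (simp add: exp_sum)
qed simp

text \<open>Separates the zeros below \<open>a n\<close>, the zero \<open>a n\<close> itself and the
  later ones, which the bounds for \<open>g\<close> treat differently.\<close>

lemma prod_lessThan_split:
  fixes h :: "nat \<Rightarrow> 'a :: comm_monoid_mult"
  shows "(\<Prod>k<Suc (n + m). h k) = (\<Prod>k<n. h k) * h n * (\<Prod>k=Suc n..n + m. h k)"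
  by (induction m) (simp_all add: mult.assoc)

text \<open>The left side has the form of the bound in \<open>t_add_le\<close> for a head start of
  \<open>L\<close> steps; with \<open>L\<close> fixed it is polynomial in \<open>n\<close>.\<close>

lemma geometric_not_polynomially_bounded:
  fixes q :: real
  assumes "q > 1"
  shows "\<exists>n\<ge>1. 1 + real (N + 2 * (n + L)) ^ L < q ^ n"
proof -
  have lim: "(\<lambda>n. (1 + real (N + 2 * (n + L)) powr real L) / q powr real n) \<longlonglongrightarrow> 0"
    using assms by real_asymp
  have "\<forall>\<^sub>F n in sequentially.
      n \<ge> max 1 L \<and> (1 + real (N + 2 * (n + L)) powr real L) / q powr real n < 1"
    by (intro eventually_conj eventually_ge_at_top order_tendstoD(2)[OF lim zero_less_one])
  then obtain n where n: "n \<ge> max 1 L"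
    "(1 + real (N + 2 * (n + L)) powr real L) / q powr real n < 1"
    using eventually_happens'[OF sequentially_bot] by blast
  have "real (N + 2 * (n + L)) powr real L = real (N + 2 * (n + L)) ^ L"
    using n(1) by (intro powr_realpow) simp
  then have "1 + real (N + 2 * (n + L)) ^ L < q ^ n"
    using n(2) assms by (simp add: powr_realpow pos_divide_less_eq del: of_nat_add of_nat_mult)
  then show ?thesis using n(1) by auto
qed

text \<open>
  The auxiliary \<open>\<eta>'\<close> leaves room between \<open>\<eta>\<close> and 1 for the factor \<open>(\<Prod>k<n. a k)^2\<close> lost in the
  lower bounds for \<open>f\<close>, and the constant 71 lets a power of \<open>a n\<close> absorb the factor 72 in
  \<open>36 * (2 * a n)^d \<le> (72 * a n)^d\<close>. The zeros are double so that \<open>f\<close> does not change sign.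
\<close>

locale double_zero_product =
  fixes \<epsilon> \<eta> \<eta>' \<tau> :: real and N :: nat
  assumes eps: "0 < \<epsilon>" "\<epsilon> < \<eta>" "\<eta> < \<eta>'" "\<eta>' < 1"
    and N: "3 \<le> N" "2 \<le> \<eta> * N" "2 \<le> (1 - \<eta>') * N"
    and \<tau>: "4 \<le> \<tau>" "71 \<le> (\<eta> / \<epsilon> - 1) * \<tau>"
begin

section \<open>The sequence of zeros\<close>

text \<open>Counts, with multiplicity, the zeros of \<open>f\<close> of modulus below
  \<open>a n\<close>.\<close>

definition d :: "nat \<Rightarrow> nat" where "d n = N + 2 * n"

definition t :: "nat \<Rightarrow> real" where "t n = \<tau> * (\<Prod>k<n. \<eta> * d k)"

definition a :: "nat \<Rightarrow> real" where "a n = exp (t n)"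

lemma t_Suc: "t (Suc n) = \<eta> * d n * t n"
  by (simp add: t_def)

lemma d_factor: "2 \<le> \<eta> * d n" "2 \<le> (1 - \<eta>') * d n"
proof -
  have "\<eta> * N \<le> \<eta> * d n" "(1 - \<eta>') * N \<le> (1 - \<eta>') * d n"
    using eps by (auto intro!: mult_left_mono simp: d_def)
  then show "2 \<le> \<eta> * d n" "2 \<le> (1 - \<eta>') * d n" using N by linarith+
qed

lemma t_ge_init: "\<tau> \<le> t n" and t_double: "2 * t n \<le> t (Suc n)"
proof -
  have dbl: "2 * t n \<le> t (Suc n)" if "\<tau> \<le> t n" for n
    using mult_right_mono[OF d_factor(1)[of n], of "t n"] that \<tau>(1) by (simp add: t_Suc)
  show *: "\<tau> \<le> t n" for n
  proof (induction n)
    case (Suc n)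
    then show ?case using dbl[of n] \<tau>(1) by linarith
  qed (simp add: t_def)
  show "2 * t n \<le> t (Suc n)" by (rule dbl[OF *])
qed

lemma t_ge: "4 \<le> t n"
  using t_ge_init[of n] \<tau>(1) by linarith

lemma a_ge: "5 \<le> a n" and a_Suc_ge: "a n * a n \<le> a (Suc n)" "5 * a n \<le> a (Suc n)"
proof -
  show "5 \<le> a n"
    using exp_ge_add_one_self[of "t n"] t_ge[of n] unfolding a_def by linarith
  show "a n * a n \<le> a (Suc n)"
    using t_double[of n] by (simp add: a_def flip: exp_add)
  then show "5 * a n \<le> a (Suc n)"
    using mult_right_mono[OF \<open>5 \<le> a n\<close>, of "a n"] \<open>5 \<le> a n\<close> by linarith
qed

lemma a_pos: "0 < a n" by (simp add: a_def)

lemma strict_mono_a: "strict_mono a"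
  using a_Suc_ge(2) a_pos by (intro strict_monoI_Suc) (smt (verit))

lemma a_ge_nat: "real n \<le> a n"
proof (induction n)
  case (Suc n)
  then show ?case using a_Suc_ge(2)[of n] a_ge[of n] by simp
qed (use a_pos[of 0] in simp)

text \<open>Each zero is at least the square of its predecessor. Dividing by the square of this
  product therefore costs at most two powers of \<open>a n\<close>.\<close>

lemma prod_a_le: "(\<Prod>k<n. a k) \<le> a n"
proof (induction n)
  case (Suc n)
  have "(\<Prod>k<Suc n. a k) \<le> a n * a n"
    using Suc a_pos[of n] by (simp add: mult_right_mono)
  also note a_Suc_ge(1)
  finally show ?case .
qed (use a_ge[of 0] in simp)

lemma a_tail_sum: "(\<Sum>k=Suc n..n + m. 2 * a n / a k) \<le> 1 / 2"
proof -
  \<comment> \<open>Consecutive ratios are at most 1/5, and the series of \<open>2 / 5 ^ j\<close>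
    over positive \<open>j\<close> sums to 1/2. The subtracted term is the geometric bound for what
    follows index \<open>n + m\<close>; it carries the induction.\<close>
  have "(\<Sum>k=Suc n..n + m. 2 * a n / a k) \<le> 1 / 2 - a n / (2 * a (n + m))"
  proof (induction m)
    case (Suc m)
    have "5 * a n / (2 * a (Suc (n + m))) \<le> a n / (2 * a (n + m))"
      using mult_left_mono[OF a_Suc_ge(2)[of "n + m"], of "a n"] a_pos[of "n + m"] a_pos[of n]
        a_pos[of "Suc (n + m)"]
      by (simp add: field_simps)
    moreover have "5 * a n / (2 * a (Suc (n + m))) =
        2 * a n / a (Suc (n + m)) + a n / (2 * a (Suc (n + m)))"
      using a_pos[of "Suc (n + m)"] by (simp add: field_simps)
    moreover have "(\<Sum>k=Suc n..n + Suc m. 2 * a n / a k) =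
        (\<Sum>k=Suc n..n + m. 2 * a n / a k) + 2 * a n / a (Suc (n + m))"
      by simp
    ultimately show ?case using Suc unfolding add_Suc_right by linarith
  qed (use a_pos[of n] in simp)
  also have "\<dots> \<le> 1 / 2" using a_pos[of n] a_pos[of "n + m"] by simp
  finally show ?thesis .
qed

section \<open>The canonical product and its bounds\<close>

text \<open>Genus 0: the reciprocals of the zeros are summable, so the factors
  \<open>1 - z / a k\<close> need no exponential correction.\<close>

sublocale W: weierstrass_product "\<lambda>n. complex_of_real (a n)" "\<lambda>_. 0"
proof
  show "complex_of_real (a n) \<noteq> 0" for n using a_pos[of n] by simp
  have "filterlim a at_top sequentially"
    by (rule filterlim_at_top_mono[OF filterlim_real_sequentially]) (simp add: a_ge_nat)
  then show "filterlim (\<lambda>n. complex_of_real (a n)) at_infinity sequentially"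
    by (intro filterlim_norm_at_top_imp_at_infinity) (simp add: a_pos less_imp_le)
  show "summable (\<lambda>n. (r / cmod (complex_of_real (a n))) ^ Suc 0)" if "r > 0" for r
  proof (rule summable_ratio_test[of "1 / 5" 0])
    fix n
    have "r / a (Suc n) \<le> r / (5 * a n)"
      using that a_Suc_ge(2)[of n] a_pos[of n] by (intro divide_left_mono) auto
    then show "norm ((r / cmod (complex_of_real (a (Suc n)))) ^ Suc 0) \<le>
        1 / 5 * norm ((r / cmod (complex_of_real (a n))) ^ Suc 0)"
      using that a_pos by (simp add: less_imp_le)
  qed simp
qed

abbreviation g :: "complex \<Rightarrow> complex" where "g \<equiv> W.f"

definition f :: "complex \<Rightarrow> complex" where "f z = z ^ N * g z ^ 2"

lemma g_lim: "(\<lambda>m. \<Prod>k<m. 1 - z / complex_of_real (a k)) \<longlonglongrightarrow> g z"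
  using has_prod_imp_tendsto'[OF W.has_prod[of z]] by (simp add: weierstrass_factor_def)

lemma norm_g_lim: "(\<lambda>m. \<Prod>k<Suc (n + m). cmod (1 - z / complex_of_real (a k))) \<longlonglongrightarrow> cmod (g z)"
proof -
  have "(\<lambda>m. \<Prod>k<m. cmod (1 - z / a k)) \<longlonglongrightarrow> cmod (g z)"
    using tendsto_norm[OF g_lim[of z]] by (simp add: prod_norm)
  then have "(\<lambda>m. \<Prod>k<m + Suc n. cmod (1 - z / a k)) \<longlonglongrightarrow> cmod (g z)"
    by (rule LIMSEQ_ignore_initial_segment)
  then show ?thesis by (simp only: add_Suc_right add.commute)
qed

text \<open>Each zero below \<open>a n\<close> contributes a factor at most \<open>2 * a n\<close>,
  the zero \<open>a n\<close> at most 3, and the tail at most \<open>exp (1 / 2)\<close>, which is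
  below 2.\<close>

lemma norm_g_le:
  assumes z: "cmod z \<le> 2 * a n"
  shows "cmod (g z) \<le> 6 * (2 * a n) ^ n"
proof (rule LIMSEQ_le_const2[OF norm_g_lim[of z n]], intro exI[of _ 0] allI impI)
  fix m
  have le: "cmod (1 - z / a k) \<le> 1 + 2 * a n / a k" for k
  proof -
    have "cmod (1 - z / a k) \<le> 1 + cmod z / a k"
      using norm_triangle_ineq4[of 1 "z / a k"] a_pos[of k] by (simp add: norm_divide)
    also have "\<dots> \<le> 1 + 2 * a n / a k" using z a_pos[of k] by (simp add: divide_right_mono)
    finally show ?thesis .
  qed
  have pos: "0 \<le> 1 + 2 * a n / a k" for k
    using a_pos[of n] a_pos[of k] by (simp add: add_nonneg_nonneg)
  have 1: "(\<Prod>k<n. cmod (1 - z / a k)) \<le> (2 * a n) ^ n"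
  proof -
    have "cmod (1 - z / a k) \<le> 2 * a n" for k
    proof -
      have "2 * a n / a k \<le> 2 * a n / 2"
        using a_pos[of n] a_ge[of k] by (intro divide_left_mono) auto
      then show ?thesis using le[of k] a_ge[of n] by simp
    qed
    then have "(\<Prod>k<n. cmod (1 - z / a k)) \<le> (\<Prod>k<n. 2 * a n)" by (intro prod_mono) auto
    then show ?thesis by simp
  qed
  have 2: "cmod (1 - z / a n) \<le> 3" using le[of n] a_pos[of n] by simp
  have "(\<Prod>k=Suc n..n + m. cmod (1 - z / a k)) \<le> (\<Prod>k=Suc n..n + m. 1 + 2 * a n / a k)"
    using le by (intro prod_mono) auto
  also have "\<dots> \<le> exp (\<Sum>k=Suc n..n + m. 2 * a n / a k)"
    using a_pos by (intro prod_one_plus_le_exp_sum) (simp add: less_imp_le)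
  also have "\<dots> \<le> exp (1 / 2)" using a_tail_sum by simp
  also have "\<dots> \<le> 2" by (rule exp_half_le2)
  finally have 3: "(\<Prod>k=Suc n..n + m. cmod (1 - z / a k)) \<le> 2" .
  have "(\<Prod>k<Suc (n + m). cmod (1 - z / a k)) \<le> (2 * a n) ^ n * 3 * 2"
    unfolding prod_lessThan_split using 1 2 3 a_pos[of n]
    by (intro mult_mono mult_nonneg_nonneg prod_nonneg) auto
  then show "(\<Prod>k<Suc (n + m). cmod (1 - z / a k)) \<le> 6 * (2 * a n) ^ n" by simp
qed

text \<open>At \<open>2 * a n\<close> the factor of \<open>a n\<close> has modulus exactly 1, the
  earlier ones at least \<open>a n / a k\<close>, and by the Weierstrass product inequality the tail
  is at least 1 minus its sum, hence at least 1/2.\<close>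

lemma norm_g_double_ge: "a n ^ n / (\<Prod>k<n. a k) / 2 \<le> cmod (g (2 * a n))"
proof (rule LIMSEQ_le_const[OF norm_g_lim[where n = n]], intro exI[of _ 0] allI impI)
  fix m
  have eq: "cmod (1 - complex_of_real (2 * a n) / a k) = \<bar>1 - 2 * a n / a k\<bar>" for k
  proof -
    have "1 - complex_of_real (2 * a n) / a k = complex_of_real (1 - 2 * a n / a k)" by simp
    then show ?thesis by (simp only: norm_of_real)
  qed
  have "a n / a k \<le> \<bar>1 - 2 * a n / a k\<bar>" if "k < n" for k
  proof -
    have "a k < a n" using strict_mono_a that by (simp add: strict_mono_less)
    then have "1 \<le> a n / a k" using a_pos[of k] by simp
    then show ?thesis by simp
  qed
  then have "(\<Prod>k<n. a n / a k) \<le> (\<Prod>k<n. \<bar>1 - 2 * a n / a k\<bar>)"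
    using a_pos by (intro prod_mono) (auto simp: less_imp_le)
  then have 1: "a n ^ n / (\<Prod>k<n. a k) \<le> (\<Prod>k<n. \<bar>1 - 2 * a n / a k\<bar>)"
    by (simp add: prod_dividef)
  have 2: "1 \<le> \<bar>1 - 2 * a n / a n\<bar>" using a_pos[of n] by simp
  have "1 / 2 \<le> 1 - (\<Sum>k=Suc n..n + m. 2 * a n / a k)" using a_tail_sum[of n m] by simp
  also have "\<dots> \<le> (\<Prod>k=Suc n..n + m. 1 - 2 * a n / a k)"
  proof (rule Weierstrass_prod_ineq)
    fix k assume k: "k \<in> {Suc n..n + m}"
    have "2 * a n \<le> a (Suc n)" using a_Suc_ge(2)[of n] a_pos[of n] by linarith
    also have "\<dots> \<le> a k" using strict_mono_a k by (simp add: strict_mono_less_eq)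
    finally show "2 * a n / a k \<in> {0..1}" using a_pos[of n] a_pos[of k] by simp
  qed
  also have "\<dots> \<le> \<bar>\<dots>\<bar>" by simp
  finally have 3: "1 / 2 \<le> (\<Prod>k=Suc n..n + m. \<bar>1 - 2 * a n / a k\<bar>)" by (simp add: abs_prod)
  have "a n ^ n / (\<Prod>k<n. a k) * 1 * (1 / 2) \<le> (\<Prod>k<Suc (n + m). \<bar>1 - 2 * a n / a k\<bar>)"
    unfolding prod_lessThan_split using 1 2 3 a_pos
    by (intro mult_mono mult_nonneg_nonneg prod_nonneg divide_nonneg_nonneg) (auto simp: less_imp_le)
  then show "a n ^ n / (\<Prod>k<n. a k) / 2 \<le> (\<Prod>k<Suc (n + m). cmod (1 - complex_of_real (2 * a n) / a k))"
    using eq by simp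
qed

text \<open>On the negative axis all factors are \<open>1 + r / a k\<close>, so nothing cancels and
  the bound holds at every radius, not only near some \<open>a n\<close>.\<close>

lemma norm_g_neg_ge:
  assumes r: "0 < r"
  shows "r ^ n / (\<Prod>k<n. a k) \<le> cmod (g (- of_real r))"
proof (rule LIMSEQ_le_const[OF norm_g_lim[where n = n]], intro exI[of _ 0] allI impI)
  fix m
  have eq: "cmod (1 - (- complex_of_real r) / a k) = 1 + r / a k" for k
  proof -
    have "1 - (- complex_of_real r) / a k = complex_of_real (1 + r / a k)" by simp
    then show ?thesis using r a_pos[of k] by (simp only: norm_of_real) simp
  qed
  have "r ^ n / (\<Prod>k<n. a k) = (\<Prod>k<n. r / a k)" by (simp add: prod_dividef)
  also have "\<dots> \<le> (\<Prod>k<n. 1 + r / a k)"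
    using r a_pos by (intro prod_mono) (auto simp: less_imp_le)
  finally have 1: "r ^ n / (\<Prod>k<n. a k) \<le> (\<Prod>k<n. 1 + r / a k)" .
  have 2: "1 \<le> 1 + r / a n" "1 \<le> (\<Prod>k=Suc n..n + m. 1 + r / a k)"
    using r a_pos by (auto intro!: prod_ge_1 simp: less_imp_le)
  have "r ^ n / (\<Prod>k<n. a k) * 1 * 1 \<le> (\<Prod>k<Suc (n + m). 1 + r / a k)"
    unfolding prod_lessThan_split using 1 2 r a_pos
    by (intro mult_mono mult_nonneg_nonneg prod_nonneg divide_nonneg_nonneg) (auto simp: less_imp_le)
  then show "r ^ n / (\<Prod>k<n. a k) \<le> (\<Prod>k<Suc (n + m). cmod (1 - (- complex_of_real r) / a k))"
    unfolding eq by simp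
qed

section \<open>Growth of \<open>f\<close> and of its maximum modulus\<close>

lemma holomorphic_f: "f holomorphic_on A"
  unfolding f_def by (intro holomorphic_intros W.holomorphic)

lemma max_mod_le_near:
  assumes r: "0 < r" "r \<le> 2 * a n"
  shows "max_mod f r \<le> 36 * (2 * a n) ^ d n"
proof (rule max_mod_le[OF r(1)])
  fix z :: complex assume z: "cmod z = r"
  have "cmod (f z) = cmod z ^ N * cmod (g z) ^ 2" by (simp add: f_def norm_mult norm_power)
  also have "\<dots> \<le> (2 * a n) ^ N * (6 * (2 * a n) ^ n) ^ 2"
    using z r norm_g_le[of z n] a_pos[of n] by (intro mult_mono power_mono) auto
  also have "\<dots> = 36 * (2 * a n) ^ d n"
    by (simp add: d_def power_add power_mult_distrib power_mult[symmetric] mult.commute)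
  finally show "cmod (f z) \<le> 36 * (2 * a n) ^ d n" .
qed

text \<open>Up to constants the left side is at most \<open>a n powr (\<epsilon> * d n)\<close>,
  while \<open>a (Suc n)\<close> has exponent \<open>\<eta> * d n\<close>; the gap pays for the
  constants.\<close>

lemma mu_le_next:
  assumes r: "0 < r" "r \<le> 2 * a n"
  shows "mu \<epsilon> f r \<le> a (Suc n)"
proof -
  have "72 \<le> exp ((\<eta> / \<epsilon> - 1) * \<tau>)"
    using exp_ge_add_one_self[of "(\<eta> / \<epsilon> - 1) * \<tau>"] \<tau>(2) by linarith
  also have "\<dots> \<le> exp ((\<eta> / \<epsilon> - 1) * t n)"
    using t_ge_init[of n] eps by (auto intro!: mult_left_mono)
  finally have "72 * a n \<le> exp ((\<eta> / \<epsilon> - 1) * t n) * exp (t n)"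
    by (simp add: a_def)
  also have "\<dots> = exp (\<eta> / \<epsilon> * t n)" by (simp add: algebra_simps flip: exp_add)
  finally have le: "72 * a n \<le> exp (\<eta> / \<epsilon> * t n)" .
  have d: "d n \<noteq> 0" using N by (simp add: d_def)
  have "max_mod f r \<le> 36 * (2 * a n) ^ d n" by (rule max_mod_le_near[OF r])
  also have "\<dots> \<le> 36 ^ d n * (2 * a n) ^ d n"
    using d a_pos[of n] by (intro mult_right_mono self_le_power) auto
  also have "\<dots> = (72 * a n) ^ d n" by (subst power_mult_distrib[symmetric]) simp
  also have "\<dots> \<le> exp (\<eta> / \<epsilon> * t n) ^ d n"
    using le a_pos[of n] by (intro power_mono) auto
  also have "\<dots> = exp (t (Suc n) / \<epsilon>)" by (simp add: t_Suc mult_ac flip: exp_of_nat_mult)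
  finally have "mu \<epsilon> f r \<le> exp (t (Suc n) / \<epsilon>) powr \<epsilon>"
    unfolding mu_def using eps max_mod_nonneg[OF holomorphic_f r(1)] by (intro powr_mono2) auto
  then show ?thesis using eps by (simp add: a_def exp_powr_real)
qed

text \<open>All radii from \<open>a n\<close> on are allowed because the iterates of the maximum
  modulus soon run far ahead of the zeros.\<close>

lemma exp_le_max_mod:
  assumes s: "t n \<le> s"
  shows "exp (\<eta>' * d n * s) \<le> max_mod f (exp s)"
proof -
  have "d n \<ge> 2" using N by (simp add: d_def)
  \<comment> \<open>By \<open>d_factor\<close>, replacing \<open>\<eta>'\<close> by 1 leaves two
    powers of \<open>exp s\<close> to spare, enough for the squared product of earlier
    zeros.\<close>
  have "exp (\<eta>' * d n * s) \<le> exp (d n * s - 2 * s)"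
    using mult_right_mono[OF d_factor(2)[of n], of s] s t_ge[of n] by (simp add: algebra_simps)
  also have "\<dots> = exp s ^ d n / exp s ^ 2"
    by (simp add: exp_diff flip: exp_of_nat_mult)
  also have "\<dots> \<le> exp s ^ d n / (\<Prod>k<n. a k) ^ 2"
  proof (intro divide_left_mono power_mono mult_pos_pos)
    show "(\<Prod>k<n. a k) \<le> exp s" using prod_a_le[of n] s by (auto simp: a_def intro: order_trans)
  qed (auto simp: a_def intro!: prod_pos prod_nonneg)
  also have "\<dots> = exp s ^ N * (exp s ^ n / (\<Prod>k<n. a k)) ^ 2"
    by (simp add: d_def power_add power_divide power_mult[symmetric] mult.commute)
  also have "\<dots> \<le> exp s ^ N * cmod (g (- of_real (exp s))) ^ 2"
    using norm_g_neg_ge[of "exp s" n] a_pos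
    by (intro mult_left_mono power_mono) (auto intro!: divide_nonneg_nonneg prod_nonneg simp: less_imp_le)
  also have "\<dots> = cmod (f (- of_real (exp s)))"
    by (simp add: f_def norm_mult norm_power del: of_real_exp)
  also have "\<dots> \<le> max_mod f (exp s)"
    by (intro max_mod_upper holomorphic_f) (simp del: of_real_exp)
  finally show ?thesis .
qed

lemma norm_f_double_ge: "2 * a (Suc n) \<le> cmod (f (2 * a n))"
proof -
  \<comment> \<open>8 pays for the factor 2 in the claim and for the 1/4 from squaring the 1/2 in
    \<open>norm_g_double_ge\<close>.\<close>
  have "(8::real) \<le> 2 ^ N" using power_increasing[OF N(1), of "2::real"] by simp
  have "a (Suc n) = exp (\<eta> * d n * t n)" by (simp add: a_def t_Suc)
  also have "\<dots> \<le> exp (d n * t n - 2 * t n)"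
  proof -
    have "\<eta> * d n * t n \<le> \<eta>' * d n * t n" 
      using eps t_ge[of n] by (intro mult_right_mono) auto
    then show ?thesis
      using mult_right_mono[OF d_factor(2)[of n], of "t n"] t_ge[of n] by (simp add: algebra_simps)
  qed
  also have "\<dots> = a n ^ d n / a n ^ 2"
    by (simp add: exp_diff a_def flip: exp_of_nat_mult)
  also have "\<dots> \<le> a n ^ d n / (\<Prod>k<n. a k) ^ 2"
    by (intro divide_left_mono power_mono mult_pos_pos prod_a_le)
      (auto simp: a_def intro!: prod_pos prod_nonneg)
  finally have "2 * a (Suc n) \<le> 2 * (a n ^ d n / (\<Prod>k<n. a k) ^ 2)" by simp
  also have "\<dots> \<le> 2 ^ N / 4 * (a n ^ d n / (\<Prod>k<n. a k) ^ 2)"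
    using \<open>8 \<le> 2 ^ N\<close> a_pos[of n] by (intro mult_right_mono) auto
  also have "\<dots> = (2 * a n) ^ N * (a n ^ n / (\<Prod>k<n. a k) / 2) ^ 2"
    by (simp add: d_def power_add power_divide power_mult_distrib power_mult[symmetric] mult_ac)
  also have "\<dots> \<le> (2 * a n) ^ N * cmod (g (2 * a n)) ^ 2"
    using norm_g_double_ge[of n] a_pos
    by (intro mult_left_mono power_mono) (auto intro!: divide_nonneg_nonneg prod_nonneg simp: less_imp_le)
  also have "\<dots> = cmod (f (2 * a n))"
    using a_pos[of n] by (simp add: f_def norm_mult norm_power)
  finally show ?thesis .
qed

section \<open>Transcendence and the slow real orbit\<close>

lemma f_zero: "f (a n) = 0"
  using W.zero[of "a n"] by (simp add: f_def)

text \<open>On the real axis \<open>g\<close> is a limit of real products, so its square is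
  nonnegative. Orbits of the modulus on the positive axis are thus orbits of
  \<open>f\<close>.\<close>

lemma f_of_nonneg_real:
  assumes "0 \<le> x"
  shows "f (of_real x) = of_real (cmod (f (of_real x)))"
proof -
  have "g (of_real x) \<in> \<real>"
  proof (rule closed_sequentially[OF closed_complex_Reals _ g_lim])
    show "(\<Prod>k<m. 1 - complex_of_real x / a k) \<in> \<real>" for m
      by (intro prod_in_Reals Reals_diff Reals_divide) auto
  qed
  then obtain y where "g (of_real x) = of_real y" by (auto elim: Reals_cases)
  then have "f (of_real x) = of_real (x ^ N * y ^ 2)" by (simp add: f_def)
  then show ?thesis using assms by (simp only: norm_of_real) simp
qed

lemma transcendental_f: "transcendental_entire f"
  unfolding transcendental_entire_def
proof (intro conjI holomorphic_f notI)
  assume "\<exists>p. \<forall>z. f z = poly p z"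
  then obtain p where p: "f z = poly p z" for z by blast
  have "p \<noteq> 0" using p[of "2 * a 0"] norm_f_double_ge[of 0] a_pos[of 1] by auto
  then have "finite {z. poly p z = 0}" by (rule poly_roots_finite)
  moreover have "range (\<lambda>n. complex_of_real (a n)) \<subseteq> {z. poly p z = 0}" using f_zero p by auto
  moreover have "inj (\<lambda>n. complex_of_real (a n))"
    using strict_mono_a by (auto simp: inj_def strict_mono_eq)
  ultimately show False using finite_subset range_inj_infinite by blast
qed

lemma slow_orbit_exists: "\<exists>z. \<forall>n. a n \<le> cmod ((f ^^ n) z) \<and> cmod ((f ^^ n) z) \<le> 2 * a n"
proof -
  define h where "h x = cmod (f (of_real x))" for x :: real
  have contf: "continuous_on UNIV f"
    by (rule holomorphic_on_imp_continuous_on[OF holomorphic_f])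
  have cont: "continuous_on UNIV h"
    unfolding h_def
    by (intro continuous_on_norm continuous_on_compose2[OF contf] continuous_on_of_real_id) auto
  have "\<exists>x. \<forall>n. (h ^^ n) x \<in> {a n..2 * a n}"
  proof (rule nested_orbit_exists[OF cont])
    fix n
    show "{a n..2 * a n} \<noteq> {}" using a_pos[of n] by simp
    show "{a (Suc n)..2 * a (Suc n)} \<subseteq> h ` {a n..2 * a n}"
    proof
      fix y assume y: "y \<in> {a (Suc n)..2 * a (Suc n)}"
      have "\<exists>x. a n \<le> x \<and> x \<le> 2 * a n \<and> h x = y"
      proof (rule IVT')
        show "h (a n) \<le> y" using f_zero y a_pos[of "Suc n"] by (simp add: h_def)
        show "y \<le> h (2 * a n)" using norm_f_double_ge[of n] y by (simp add: h_def)
      qed (use a_pos[of n] cont in \<open>auto intro: continuous_on_subset\<close>)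
      then show "y \<in> h ` {a n..2 * a n}" by force
    qed
  qed auto
  then obtain x where x: "(h ^^ n) x \<in> {a n..2 * a n}" for n by blast
  have hf: "f (of_real w) = of_real (h w)" if "0 \<le> w" for w
    using f_of_nonneg_real[OF that] by (simp only: h_def)
  have "(f ^^ n) (of_real x) = of_real ((h ^^ n) x)" for n
  proof (induction n)
    case (Suc n)
    have "0 \<le> (h ^^ n) x" using x[of n] a_pos[of n] by auto
    then show ?case using Suc hf by simp
  qed simp
  then have "cmod ((f ^^ n) (of_real x)) = (h ^^ n) x" for n
    using x[of n] a_pos[of n] by simp
  then have "a n \<le> cmod ((f ^^ n) (of_real x)) \<and> cmod ((f ^^ n) (of_real x)) \<le> 2 * a n" for n
    using x[of n] by simp
  then show ?thesis by blast
qed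

section \<open>Escape rate of the slow orbit\<close>

lemma slow_orbit_quite_fast:
  assumes z: "\<And>n. a n \<le> cmod ((f ^^ n) z)"
  shows "z \<in> quite_fast_escaping_set_at \<epsilon> f"
proof -
  obtain R where R: "admissible_radius (mu \<epsilon> f) R"
    using mu_admissible_exists[OF transcendental_f eps(1)] by blast
  \<comment> \<open>Since \<open>a l\<close> is at least \<open>l\<close>, the comparison starts
    with \<open>R\<close> below \<open>a l\<close>; then \<open>mu_le_next\<close> advances the
    index by one per iteration.\<close>
  obtain l :: nat where l: "max 1 R \<le> l" using real_arch_simple by blast
  have "(mu \<epsilon> f ^^ n) R \<le> a (n + l)" for n
  proof (induction n)
    case 0
    then show ?case using l a_ge_nat[of l] by simp
  next
    case (Suc n)
    have "0 < (mu \<epsilon> f ^^ n) R"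
      using admissible_iterates(1)[OF R, of n] R by (auto simp: admissible_radius_def)
    then have "mu \<epsilon> f ((mu \<epsilon> f ^^ n) R) \<le> a (Suc (n + l))"
      using Suc a_pos[of "n + l"] by (intro mu_le_next) auto
    then show ?case by simp
  qed
  then have "(mu \<epsilon> f ^^ n) R \<le> cmod ((f ^^ (n + l)) z)" for n
    using z order_trans by blast
  then show ?thesis
    unfolding quite_fast_escaping_set_at_def using R l by auto
qed

lemma t_add_le: "t (n + L) \<le> t n * real (N + 2 * (n + L)) ^ L"
proof -
  have "t (n + j) \<le> t n * real (N + 2 * (n + L)) ^ j" if "j \<le> L" for j
    using that
  proof (induction j)
    case (Suc j)
    \<comment> \<open>Bounding all the degrees by \<open>N + 2 * (n + L)\<close>, independent of
      \<open>j\<close>, turns the product into a power.\<close>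
    have "\<eta> * d (n + j) \<le> 1 * real (N + 2 * (n + L))"
      using eps Suc.prems by (intro mult_mono) (auto simp: d_def)
    then have "t (n + Suc j) \<le> real (N + 2 * (n + L)) * t (n + j)"
      using t_ge[of "n + j"] by (simp add: t_Suc mult_right_mono)
    also have "\<dots> \<le> real (N + 2 * (n + L)) * (t n * real (N + 2 * (n + L)) ^ j)"
      using Suc by (intro mult_left_mono) auto
    finally show ?case by (simp add: mult_ac)
  qed simp
  then show ?thesis by blast
qed

lemma slow_orbit_not_fast:
  assumes z: "\<And>n. cmod ((f ^^ n) z) \<le> 2 * a n"
  shows "z \<notin> fast_escaping_set f"
proof
  let ?M = "max_mod f"
  define q where "q = \<eta>' / \<eta>"
  have q: "q > 1" using eps by (simp add: q_def)
  assume "z \<in> fast_escaping_set f"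
  then obtain R l where R: "admissible_radius ?M R"
    and l: "\<And>n. n \<ge> 1 \<Longrightarrow> (?M ^^ n) R \<le> cmod ((f ^^ (n + l)) z)"
    unfolding fast_escaping_set_def by auto
  have "\<exists>k. a 0 \<le> (?M ^^ k) R"
    by (rule admissible_iterates_unbounded[OF R]) (rule max_mod_le_limit[OF holomorphic_f])
  then obtain k where k: "a 0 \<le> (?M ^^ k) R" by blast
  \<comment> \<open>Per step the logarithm grows at least by the factor \<open>\<eta>' * d n\<close>
    on the right and \<open>t n\<close> grows by exactly \<open>\<eta> * d n\<close>, so their ratio
    gains \<open>q\<close> each time.\<close>
  have M: "exp (q ^ n * t n) \<le> (?M ^^ (n + k)) R" for n
  proof (induction n)
    case (Suc n)
    have "exp (q ^ Suc n * t (Suc n)) = exp (\<eta>' * d n * (q ^ n * t n))"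
      using eps by (simp add: q_def t_Suc)
    also have "\<dots> \<le> ?M (exp (q ^ n * t n))"
      using q t_ge[of n] by (intro exp_le_max_mod) simp
    also have "\<dots> \<le> ?M ((?M ^^ (n + k)) R)"
      using Suc by (intro max_mod_mono holomorphic_f) auto
    finally show ?case by simp
  qed (use k in \<open>simp add: a_def\<close>)
  obtain n where n: "n \<ge> 1" "1 + real (N + 2 * (n + (k + l))) ^ (k + l) < q ^ n"
    using geometric_not_polynomially_bounded[OF q] by blast
  have "exp (q ^ n * t n) \<le> 2 * a (n + (k + l))"
    using M[of n] l[of "n + k"] z[of "n + k + l"] n(1) by (simp add: add.assoc)
  \<comment> \<open>The factor 2 is absorbed into \<open>a n\<close>, which produces the summand 1
    in the choice of \<open>n\<close>.\<close>
  also have "\<dots> \<le> exp (t n) * a (n + (k + l))"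
    using a_ge[of n] a_pos[of "n + (k + l)"] unfolding a_def[of n] by (intro mult_right_mono) auto
  also have "\<dots> = exp (t n + t (n + (k + l)))" by (simp add: a_def exp_add)
  finally have "q ^ n * t n \<le> t n + t (n + (k + l))" by simp
  also have "\<dots> \<le> (1 + real (N + 2 * (n + (k + l))) ^ (k + l)) * t n"
    using t_add_le[of n "k + l"] by (simp add: algebra_simps)
  finally show False using n(2) t_ge[of n] by simp
qed

end

theorem theorem3p2:
  fixes \<epsilon> :: real
  assumes "0 < \<epsilon>" and "\<epsilon> < 1"
  shows "\<exists>f :: complex \<Rightarrow> complex. transcendental_entire f \<and>
           quite_fast_escaping_set_at \<epsilon> f \<noteq> fast_escaping_set f \<and>
           quite_fast_escaping_set f \<noteq> fast_escaping_set f"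
proof -
  \<comment> \<open>These divide the interval from \<open>\<epsilon>\<close> to 1 into three equal
    parts; \<open>N\<close> and \<open>\<tau>\<close> are then taken large enough for the
    gaps.\<close>
  define \<eta> \<eta>' where "\<eta> = (2 * \<epsilon> + 1) / 3" and "\<eta>' = (\<epsilon> + 2) / 3"
  have eta: "0 < \<eta>" "\<epsilon> < \<eta>" "\<eta> < \<eta>'" "\<eta>' < 1"
    using assms by (auto simp: \<eta>_def \<eta>'_def)
  obtain N :: nat where N: "max 3 (max (2 / \<eta>) (2 / (1 - \<eta>'))) \<le> N"
    using real_arch_simple by blast
  define \<tau> where "\<tau> = max 4 (71 / (\<eta> / \<epsilon> - 1))"
  have pos: "0 < \<eta> / \<epsilon> - 1" using eta assms by simp
  have "71 / (\<eta> / \<epsilon> - 1) \<le> \<tau>" unfolding \<tau>_def by (rule max.cobounded2)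
  then have \<tau>: "71 \<le> (\<eta> / \<epsilon> - 1) * \<tau>"
    by (simp only: pos_divide_le_eq[OF pos] mult.commute)
  interpret double_zero_product \<epsilon> \<eta> \<eta>' \<tau> N
    by standard (use assms eta N \<tau> in \<open>auto simp: \<tau>_def pos_divide_le_eq mult.commute\<close>)
  obtain z where z: "\<And>n. a n \<le> cmod ((f ^^ n) z)" "\<And>n. cmod ((f ^^ n) z) \<le> 2 * a n"
    using slow_orbit_exists by blast
  have in_Q: "z \<in> quite_fast_escaping_set_at \<epsilon> f" by (rule slow_orbit_quite_fast[OF z(1)])
  then have "z \<in> quite_fast_escaping_set f"
    using assms by (auto simp: quite_fast_escaping_set_def)
  with in_Q slow_orbit_not_fast[OF z(2)] transcendental_f show ?thesis by blast
qed

end
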